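(* For every integer $m\ge0$, $$\sum_{n=0}^{\infty}\frac{1}{64^n}\binom{2n}{n}\binom{4n}{2n}\frac{1}{2n+m+1}=\frac{2}{\pi}\int_0^1\frac{x^m}{\sqrt{1+x}}\,K\!\left(\sqrt{\frac{2x}{1+x}}\right)dx .$$ If $m=2\ell+1$ with $\ell$ a non-negative integer, the series equals $$\frac12\sum_{n=0}^{\infty}\frac{1}{64^n}\binom{2n}{n}\binom{4n}{2n}\frac{1}{n+\ell+1}.$$ If $m=2\ell$ with $\ell$ a non-negative integer, then $$\sum_{n=0}^{\infty}\frac{1}{64^n}\binom{2n}{n}\binom{4n}{2n}\frac{1}{2n+2\ell+1}=\frac{1}{\pi}\,\frac{4^\ell\binom{2\ell}{\ell}}{(4\ell+1)\binom{4\ell}{2\ell}}\left(4\log(1+\sqrt2)+\sqrt2\sum_{j=1}^{\ell}\frac{(4j-3)\binom{4j-4}{2j-2}}{(2j-1)^2\,4^{j-1}\binom{2j-2}{j-1}}\right).$$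
   Context: $K(k)=\int_0^{\pi/2}\frac{d\theta}{\sqrt{1-k^2\sin^2\theta}}$ is the complete elliptic integral of the first kind in the modulus convention. *)

theory Defs
  imports "HOL-Analysis.Analysis"
begin

text \<open>
  Complete elliptic integral of the first kind, in the modulus convention (the argument is
  \<open>k\<close>, not the parameter \<open>k\<^sup>2\<close>).  It is meaningful for \<open>\<bar>k\<bar> < 1\<close>; at \<open>k = 1\<close> the integral
  diverges and the integral operator returns \<open>0\<close>.
\<close>

definition ellK :: "real \<Rightarrow> real" where
  "ellK k = integral {0..pi/2} (\<lambda>\<theta>. 1 / sqrt (1 - k\<^sup>2 * (sin \<theta>)\<^sup>2))"

end

theory Submission
  imports Defs "HOL-Real_Asymp.Real_Asymp"
begin

text \<open>
  Let \<open>w n = C(2n,n) / 4^n\<close> be the Wallis ratio. It plays two roles: it is the coefficient of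
  \<open>y^n\<close> in \<open>1 / sqrt (1 - y)\<close>, and it is the mean value of \<open>cos^(2n)\<close>. The weight of the series
  is \<open>a n = w n * w (2n)\<close>, and reading one factor in each way turns \<open>a n\<close> into an integral.

  The integral formula. Since \<open>(1 + x) (1 - 2x/(1 + x) sin\<^sup>2 \<theta>) = 1 + x cos 2\<theta>\<close>, the function
  \<open>K(sqrt (2x/(1 + x))) / sqrt (1 + x)\<close> is the integral of \<open>1 / sqrt (1 + x cos 2\<theta>)\<close> over
  \<open>[0, \<pi>/2]\<close>. Expanding the integrand, the odd powers of the cosine cancel under
  \<open>\<theta> \<mapsto> \<pi>/2 - \<theta>\<close> and the even ones give \<open>\<pi>/2\<close> times the sum of \<open>a n * x^(2n)\<close>
  (\<open>quarter_coeff_sums\<close>). Multiplying by \<open>x^m\<close> and integrating over \<open>[0, 1]\<close> produces the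
  factors \<open>1 / (2n + m + 1)\<close>. For odd \<open>m\<close> these are \<open>1/2 * 1 / (n + l + 1)\<close>.

  The closed form for \<open>m = 2l\<close>. The ratio \<open>a (n+1) / a n\<close> is rational in \<open>n\<close>, so the moments
  \<open>M s = (\<Sum>n. a n / (n + s))\<close> satisfy a two-term recurrence, obtained by telescoping
  \<open>n\<^sup>2 a n / (n + s)\<close> (\<open>quarter_coeff_moment_Suc\<close>). Its inhomogeneous term is the limit
  \<open>1 / (sqrt 2 \<pi>)\<close> of \<open>n * a n\<close>. The stated prefactor (without \<open>1/\<pi>\<close>) solves the homogeneous recurrence, and
  the finite sum over \<open>j\<close> collects the inhomogeneous terms divided by it
  (\<open>suminf_quarter_coeff_even\<close>). For the initial value \<open>l = 0\<close> (\<open>suminf_quarter_coeff_0\<close>), the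
  factors \<open>w (2n) / (2n + 1)\<close> sum against \<open>y^(2n)\<close> to \<open>(sqrt (1 + y) - sqrt (1 - y)) / y\<close>,
  which for \<open>y = cos 2t\<close> collapses to \<open>sqrt 2 / (cos t + sin t)\<close>; integrating this over
  \<open>[0, \<pi>/4]\<close> gives \<open>ln (1 + sqrt 2)\<close>.

  All series that are integrated termwise have nonnegative terms, so monotone convergence
  suffices throughout.
\<close>

section \<open>Termwise integration and even parts of power series\<close>

text \<open>
  Summability of the integrals \<open>I\<close> bounds the integrals of the increasing partial sums, so the
  monotone convergence theorem applies. Nonnegativity and pointwise convergence are asked for in
  the open interval only: the elliptic integral below is singular at the right end point.
\<close>

lemma has_integral_suminf_nonneg:
  fixes f :: "nat \<Rightarrow> real \<Rightarrow> real"
  assumes int: "\<And>n. (f n has_integral I n) {a..b}"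
    and nonneg: "\<And>n x. x \<in> {a<..<b} \<Longrightarrow> 0 \<le> f n x"
    and I: "summable I"
    and g: "\<And>x. x \<in> {a<..<b} \<Longrightarrow> (\<lambda>n. f n x) sums g x"
  shows "(g has_integral suminf I) {a..b}"
proof -
  define S where "S N x = (\<Sum>n<N. f n x)" for N x
  have S: "(S N has_integral (\<Sum>n<N. I n)) {a<..<b}" for N
    unfolding S_def has_integral_Icc_iff_Ioo[symmetric]
    by (intro has_integral_sum int) auto
  have lim: "(\<lambda>N. \<Sum>n<N. I n) \<longlonglongrightarrow> suminf I"
    using I by (simp add: summable_LIMSEQ)
  have "g integrable_on {a<..<b} \<and>
        (\<lambda>N. integral {a<..<b} (S N)) \<longlonglongrightarrow> integral {a<..<b} g"
  proof (rule monotone_convergence_increasing)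
    show "S N integrable_on {a<..<b}" for N
      using S by blast
    show "S N x \<le> S (Suc N) x" if "x \<in> {a<..<b}" for N x
      using nonneg[OF that] by (simp add: S_def)
    show "(\<lambda>N. S N x) \<longlonglongrightarrow> g x" if "x \<in> {a<..<b}" for x
      using g[OF that] by (simp add: S_def sums_def)
    have "range (\<lambda>N. integral {a<..<b} (S N)) = range (\<lambda>N. \<Sum>n<N. I n)"
      using integral_unique[OF S] by simp
    then show "bounded (range (\<lambda>N. integral {a<..<b} (S N)))"
      using convergent_imp_bounded[OF lim] by simp
  qed
  moreover have "(\<lambda>N. integral {a<..<b} (S N)) = (\<lambda>N. \<Sum>n<N. I n)"
    using integral_unique[OF S] by simp
  ultimately have "g integrable_on {a<..<b}" "integral {a<..<b} g = suminf I"
    using lim LIMSEQ_unique by auto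
  then have "(g has_integral suminf I) {a<..<b}"
    by (simp add: has_integral_iff)
  then show ?thesis
    by (simp only: has_integral_Icc_iff_Ioo)
qed

lemma sums_even_terms:
  fixes f :: "nat \<Rightarrow> real"
  assumes s: "(\<lambda>n. f n * y ^ n) sums s" and t: "(\<lambda>n. f n * (- y) ^ n) sums t"
  shows "(\<lambda>n. f (2*n) * y ^ (2*n)) sums ((s + t) / 2)"
proof -
  let ?h = "\<lambda>n. (f n * y ^ n + f n * (- y) ^ n) / 2"
  have "?h sums ((s + t) / 2)"
    by (intro sums_divide sums_add s t)
  moreover have "?h n = 0" if "n \<notin> range (\<lambda>n. 2 * n)" for n
  proof -
    have "odd n" using that by (auto elim: evenE)
    then show ?thesis by simp
  qed
  ultimately have "(\<lambda>n. ?h (2*n)) sums ((s + t) / 2)"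
    by (subst sums_mono_reindex) (auto simp: strict_mono_def)
  then show ?thesis by simp
qed

section \<open>The Wallis ratio\<close>

definition wallis_ratio :: "nat \<Rightarrow> real" where
  "wallis_ratio n = real (2*n choose n) / 4 ^ n"

lemma wallis_ratio_0 [simp]: "wallis_ratio 0 = 1"
  by (simp add: wallis_ratio_def)

lemma wallis_ratio_pos: "0 < wallis_ratio n"
  by (simp add: wallis_ratio_def)

lemma wallis_ratio_eq_pochhammer: "wallis_ratio n = pochhammer (1/2) n / fact n"
proof -
  have "real (2*n choose n) = fact (2*n) / (fact n * fact n)"
    by (subst binomial_fact) (auto simp: mult_2)
  then show ?thesis
    by (simp add: wallis_ratio_def fact_double power_mult)
qed

lemma wallis_ratio_Suc: "wallis_ratio (Suc n) = (2*real n + 1) / (2*real n + 2) * wallis_ratio n"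
proof -
  have "pochhammer (1/2::real) (Suc n) = pochhammer (1/2) n * ((2*real n + 1) / 2)"
    by (simp add: pochhammer_Suc field_simps)
  moreover have "fact (Suc n) = (real n + 1) * fact n"
    by (simp add: add_ac)
  ultimately have "wallis_ratio (Suc n)
      = (pochhammer (1/2) n * ((2*real n + 1) / 2)) / ((real n + 1) * fact n)"
    by (simp only: wallis_ratio_eq_pochhammer)
  also have "\<dots> = (2*real n + 1) / (2*real n + 2) * (pochhammer (1/2) n / fact n)"
    by (simp add: divide_simps)
  finally show ?thesis by (simp only: wallis_ratio_eq_pochhammer)
qed

lemma wallis_ratio_le_1: "wallis_ratio n \<le> 1"
proof (induction n)
  case (Suc n)
  have "(2*real n + 1) / (2*real n + 2) * wallis_ratio n \<le> 1 * 1"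
    by (rule mult_mono) (use Suc wallis_ratio_pos[of n] in auto)
  then show ?case by (simp add: wallis_ratio_Suc)
qed simp

text \<open>
  This is the binomial series with exponent \<open>-1/2\<close>: up to sign, \<open>-1/2\<close> choose \<open>n\<close> is
  \<open>pochhammer (1/2) n / fact n\<close>.
\<close>

lemma wallis_ratio_sums:
  fixes y :: real
  assumes "\<bar>y\<bar> < 1"
  shows "(\<lambda>n. wallis_ratio n * y ^ n) sums (1 / sqrt (1 - y))"
proof -
  have "((-1/2) gchoose n) * (- y) ^ n = wallis_ratio n * y ^ n" for n
  proof -
    have "(- 1) ^ n * (- y) ^ n = y ^ n"
      by (simp flip: power_mult_distrib)
    then show ?thesis
      by (simp add: gbinomial_pochhammer wallis_ratio_eq_pochhammer)
  qed
  moreover have "(\<lambda>n. ((-1/2) gchoose n) * (- y) ^ n) sums (1 + - y) powr (-1/2)"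
    by (rule gen_binomial_real) (use assms in simp)
  moreover have "(1 + - y) powr (-1/2) = 1 / sqrt (1 - y)"
  proof -
    have "(1 - y) powr (- (1/2)) = inverse (sqrt (1 - y))"
      unfolding powr_minus using assms by (subst powr_half_sqrt) auto
    then show ?thesis by (simp add: inverse_eq_divide)
  qed
  ultimately show ?thesis by (simp only:)
qed

lemma wallis_ratio_even_sums:
  fixes y :: real
  assumes "\<bar>y\<bar> < 1"
  shows "(\<lambda>n. wallis_ratio (2*n) * y ^ (2*n)) sums ((1 / sqrt (1 - y) + 1 / sqrt (1 + y)) / 2)"
  using sums_even_terms[OF wallis_ratio_sums wallis_ratio_sums, of y] assms by simp

text \<open>
  The right-hand side times \<open>y\<close> is the integral from \<open>0\<close> to \<open>y\<close> of the even part in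
  \<open>wallis_ratio_even_sums\<close>, because \<open>sqrt (1 + t) - sqrt (1 - t)\<close> is a primitive of it.
\<close>

lemma wallis_ratio_even_integrated_sums:
  fixes y :: real
  assumes y: "0 < y" "y < 1"
  shows "(\<lambda>n. wallis_ratio (2*n) * y ^ (2*n) / (2*real n + 1)) sums
           ((sqrt (1 + y) - sqrt (1 - y)) / y)"
proof -
  let ?I = "\<lambda>n. wallis_ratio (2*n) * (y ^ Suc (2*n) / real (Suc (2*n)))"
  let ?g = "\<lambda>t. (1 / sqrt (1 - t) + 1 / sqrt (1 + t)) / 2"
  have summ: "summable ?I"
  proof (rule summable_comparison_test')
    show "summable (\<lambda>n. wallis_ratio (2*n) * y ^ (2*n))"
      using wallis_ratio_even_sums[of y] y by (auto intro: sums_summable)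
    have "y ^ Suc (2*n) / real (Suc (2*n)) \<le> y ^ (2*n) / 1" for n
      by (rule frac_le) (use y in \<open>auto simp: mult_left_le_one_le\<close>)
    then have "?I n \<le> wallis_ratio (2*n) * y ^ (2*n)" for n
      using wallis_ratio_pos[of "2*n"] by (intro mult_left_mono) auto
    moreover have "0 \<le> ?I n" for n
      using y wallis_ratio_pos[of "2*n"] by simp
    ultimately show "norm (?I n) \<le> wallis_ratio (2*n) * y ^ (2*n)" for n
      by (simp only: real_norm_def abs_of_nonneg)
  qed
  have "(?g has_integral suminf ?I) {0..y}"
  proof (rule has_integral_suminf_nonneg[OF _ _ summ])
    fix n
    have "((\<lambda>t. t ^ (2*n)) has_integral (y ^ Suc (2*n) / real (Suc (2*n)) - 0 ^ Suc (2*n) / real (Suc (2*n)))) {0..y}"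
      by (rule fundamental_theorem_of_calculus)
        (use y in \<open>auto intro!: derivative_eq_intros simp flip: has_real_derivative_iff_has_vector_derivative simp del: power_Suc\<close>)
    from has_integral_mult_right[OF this, of "wallis_ratio (2*n)"]
    show "((\<lambda>t. wallis_ratio (2*n) * t ^ (2*n)) has_integral ?I n) {0..y}"
      by simp
  next
    show "0 \<le> wallis_ratio (2*n) * t ^ (2*n)" if "t \<in> {0<..<y}" for n t
      using that wallis_ratio_pos[of "2*n"] by simp
  next
    show "(\<lambda>n. wallis_ratio (2*n) * t ^ (2*n)) sums ?g t" if "t \<in> {0<..<y}" for t
      using that y by (intro wallis_ratio_even_sums) auto
  qed
  moreover have "(?g has_integral ((sqrt (1 + y) - sqrt (1 - y)) - (sqrt (1 + 0) - sqrt (1 - 0)))) {0..y}"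
    by (rule fundamental_theorem_of_calculus)
      (use y in \<open>auto intro!: derivative_eq_intros simp: divide_simps simp flip: has_real_derivative_iff_has_vector_derivative\<close>)
  ultimately have "suminf ?I = (sqrt (1 + y) - sqrt (1 - y)) - (sqrt (1 + 0) - sqrt (1 - 0))"
    by (rule has_integral_unique)
  then have "suminf ?I = sqrt (1 + y) - sqrt (1 - y)"
    by (simp only:) simp
  then have "?I sums (sqrt (1 + y) - sqrt (1 - y))"
    using summ by (simp add: sums_iff)
  from sums_divide[OF this, of y] show ?thesis
    using y by (simp add: add.commute)
qed

text \<open>
  The primitive \<open>sin (2t) cos (2t)^(2n+1)\<close> vanishes at both end points, which yields the
  recurrence of the Wallis ratios. A quarter of the period is enough, and on it
  \<open>cos (2t)\<close> stays nonnegative, which the evaluation of the initial value needs.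
\<close>

lemma has_integral_cos_double_even_power:
  "((\<lambda>t. cos (2*t) ^ (2*n)) has_integral (pi / 4 * wallis_ratio n)) {0..pi/4}"
proof (induction n)
  case 0
  show ?case using has_integral_const_real[of "1::real" 0 "pi/4"] by simp
next
  case (Suc n)
  let ?F = "\<lambda>t. sin (2*t) * cos (2*t) ^ Suc (2*n) / (4*real n + 4)"
  let ?q = "(2*real n + 1) / (2*real n + 2)"
  have "((\<lambda>t. cos (2*t) ^ (2 * Suc n) - ?q * cos (2*t) ^ (2*n)) has_integral
          (?F (pi/4) - ?F 0)) {0..pi/4}"
  proof (rule fundamental_theorem_of_calculus)
    fix t :: real
    have "((\<lambda>t. sin (2*t)) has_real_derivative 2 * cos (2*t)) (at t within {0..pi/4})"
      and "((\<lambda>t. cos (2*t)) has_real_derivative - 2 * sin (2*t)) (at t within {0..pi/4})"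
      by (auto intro!: derivative_eq_intros)
    then have "(?F has_real_derivative
            (2 * cos (2*t) * cos (2*t) ^ Suc (2*n)
              + (1 + of_nat (2*n)) * (- 2 * sin (2*t) * cos (2*t) ^ (2*n)) * sin (2*t))
            / (4*real n + 4)) (at t within {0..pi/4})"
      by (intro DERIV_cdivide DERIV_mult DERIV_power_Suc)
    also have "2 * cos (2*t) * cos (2*t) ^ Suc (2*n)
          + (1 + of_nat (2*n)) * (- 2 * sin (2*t) * cos (2*t) ^ (2*n)) * sin (2*t)
        = cos (2*t) ^ (2*n) * (2 * (cos (2*t))\<^sup>2 - 2 * (2 * real n + 1) * (sin (2*t))\<^sup>2)"
      by (simp add: power2_eq_square algebra_simps)
    also have "\<dots> / (4*real n + 4) = cos (2*t) ^ (2 * Suc n) - ?q * cos (2*t) ^ (2*n)"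
      unfolding sin_squared_eq
      by (simp add: divide_simps) (simp add: algebra_simps power2_eq_square)
    finally show "(?F has_vector_derivative (cos (2*t) ^ (2 * Suc n) - ?q * cos (2*t) ^ (2*n)))
        (at t within {0..pi/4})"
      by (simp only: has_real_derivative_iff_has_vector_derivative)
  qed simp
  from has_integral_add[OF this has_integral_mult_right[OF Suc.IH, of ?q]]
  show ?case by (simp add: wallis_ratio_Suc mult_ac)
qed

text \<open>
  Apart from a factor tending to \<open>1\<close>, these are the terms of the Gauss product for
  \<open>1 / Gamma (1/2)\<close>.
\<close>

lemma wallis_ratio_asymptotic: "(\<lambda>n. sqrt (real n) * wallis_ratio n) \<longlonglongrightarrow> 1 / sqrt pi"
proof -
  have *: "eventually (\<lambda>n. rGamma_series (1/2 :: real) n * (real n / (real n + 1/2))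
             = sqrt (real n) * wallis_ratio n) sequentially"
    using eventually_gt_at_top[of 0]
  proof eventually_elim
    case (elim n)
    have "exp (1/2 * ln (real n)) = sqrt (real n)"
      using elim by (simp add: powr_half_sqrt[symmetric] powr_def)
    then have "rGamma_series (1/2 :: real) n = (1/2 + real n) * wallis_ratio n / sqrt (real n)"
      by (simp add: rGamma_series_def wallis_ratio_eq_pochhammer pochhammer_Suc)
    then have "rGamma_series (1/2 :: real) n * (real n / (real n + 1/2))
        = wallis_ratio n * (real n / sqrt (real n))"
      by (simp add: add.commute)
    then show ?case by (simp add: real_div_sqrt mult.commute)
  qed
  have "(\<lambda>n. real n / (real n + 1/2)) \<longlonglongrightarrow> 1"
    by real_asymp
  from tendsto_mult[OF rGamma_series_LIMSEQ this, of "1/2"] * 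
  have "(\<lambda>n. sqrt (real n) * wallis_ratio n) \<longlonglongrightarrow> rGamma (1/2) * 1"
    by (rule Lim_transform_eventually)
  then show ?thesis
    by (simp add: rGamma_inverse_Gamma Gamma_one_half_real inverse_eq_divide)
qed

section \<open>The coefficients of the series and their moments\<close>

text \<open>
  These are the coefficients of the hypergeometric series \<open>\<^sub>2F\<^sub>1(1/4, 3/4; 1; z)\<close>, as
  \<open>quarter_coeff_Suc\<close> shows; hence the name. The factorisation is kept as the definition because
  the two factors are expanded in different ways.
\<close>

definition quarter_coeff :: "nat \<Rightarrow> real" where
  "quarter_coeff n = wallis_ratio n * wallis_ratio (2*n)"

lemma quarter_coeff_eq:
  "quarter_coeff n = 1 / 64 ^ n * real ((2*n) choose n) * real ((4*n) choose (2*n))"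
proof -
  have "(64::real) ^ n = 4 ^ n * 4 ^ (2*n)"
    by (simp add: power_mult flip: power_mult_distrib)
  then show ?thesis by (simp add: quarter_coeff_def wallis_ratio_def)
qed

lemma quarter_coeff_pos: "0 < quarter_coeff n"
  by (simp add: quarter_coeff_def wallis_ratio_pos)

lemma quarter_coeff_Suc:
  "(real n + 1)\<^sup>2 * quarter_coeff (Suc n) = (real n + 1/4) * (real n + 3/4) * quarter_coeff n"
proof -
  define N where "N = real n"
  have "N \<ge> 0" by (simp add: N_def)
  then have rational: "(N + 1)\<^sup>2 * ((2*N + 1) / (2*N + 2) * ((4*N + 3) / (4*N + 4) * ((4*N + 1) / (4*N + 2))))
      = (N + 1/4) * (N + 3/4)"
    by (simp add: divide_simps) (simp add: power2_eq_square algebra_simps)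
  have "wallis_ratio (2 * Suc n)
      = (2*(2*N + 1) + 1) / (2*(2*N + 1) + 2) * ((2*(2*N) + 1) / (2*(2*N) + 2) * wallis_ratio (2*n))"
    using wallis_ratio_Suc[of "Suc (2*n)"] wallis_ratio_Suc[of "2*n"] by (simp add: N_def add_ac)
  moreover have "2*(2*N + 1) + 1 = 4*N + 3" "2*(2*N + 1) + 2 = 4*N + 4"
    "2*(2*N) + 1 = 4*N + 1" "2*(2*N) + 2 = 4*N + 2"
    by simp_all
  ultimately have "wallis_ratio (2 * Suc n)
      = (4*N + 3) / (4*N + 4) * ((4*N + 1) / (4*N + 2)) * wallis_ratio (2*n)"
    by (simp only: mult.assoc)
  then have "(N + 1)\<^sup>2 * quarter_coeff (Suc n)
      = (N + 1)\<^sup>2 * ((2*N + 1) / (2*N + 2) * ((4*N + 3) / (4*N + 4) * ((4*N + 1) / (4*N + 2))))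
        * quarter_coeff n"
    unfolding quarter_coeff_def wallis_ratio_Suc N_def[symmetric] by (simp only: mult_ac)
  from this[unfolded rational] show ?thesis by (simp only: N_def)
qed

lemma quarter_coeff_asymptotic: "(\<lambda>n. real n * quarter_coeff n) \<longlonglongrightarrow> 1 / (sqrt 2 * pi)"
proof -
  have "filterlim (\<lambda>n::nat. 2 * n) sequentially sequentially"
    by (rule filterlim_subseq) (simp add: strict_mono_def)
  from filterlim_compose[OF wallis_ratio_asymptotic this]
  have "(\<lambda>n. sqrt (real (2*n)) * wallis_ratio (2*n)) \<longlonglongrightarrow> 1 / sqrt pi" .
  from tendsto_mult[OF tendsto_mult[OF wallis_ratio_asymptotic this] tendsto_const, of "1 / sqrt 2"]
  have "(\<lambda>n. (sqrt (real n) * wallis_ratio n) * (sqrt (real (2*n)) * wallis_ratio (2*n)) * (1 / sqrt 2))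
          \<longlonglongrightarrow> 1 / sqrt pi * (1 / sqrt pi) * (1 / sqrt 2)" .
  moreover have "(sqrt (real n) * wallis_ratio n) * (sqrt (real (2*n)) * wallis_ratio (2*n)) * (1 / sqrt 2)
      = real n * quarter_coeff n" for n
    by (simp add: quarter_coeff_def real_sqrt_mult)
  moreover have "1 / sqrt pi * (1 / sqrt pi) * (1 / sqrt 2) = 1 / (sqrt 2 * pi)"
    by simp
  ultimately show ?thesis by (simp only:)
qed

text \<open>
  Since \<open>n * a n\<close> converges, it is bounded, and the terms are dominated by a multiple of
  \<open>1 / n\<^sup>2\<close>.
\<close>

lemma summable_quarter_coeff_div:
  assumes "s > 0"
  shows "summable (\<lambda>n. quarter_coeff n / (real n + s))"
proof -
  have "Bseq (\<lambda>n. real n * quarter_coeff n)"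
    using quarter_coeff_asymptotic by (intro convergent_imp_Bseq convergentI)
  then obtain B where B: "\<And>n. norm (real n * quarter_coeff n) \<le> B"
    by (auto simp: Bseq_def)
  show ?thesis
  proof (rule summable_comparison_test_ev)
    show "summable (\<lambda>n. B * inverse (real n ^ 2))"
      by (intro summable_mult inverse_power_summable) simp
    show "eventually (\<lambda>n. norm (quarter_coeff n / (real n + s)) \<le> B * inverse (real n ^ 2)) sequentially"
      using eventually_gt_at_top[of 0]
    proof eventually_elim
      case (elim n)
      have "quarter_coeff n / (real n + s) \<le> quarter_coeff n / real n"
        using elim assms quarter_coeff_pos[of n] by (intro divide_left_mono) auto
      also have "\<dots> = (real n * quarter_coeff n) / (real n)\<^sup>2"
        using elim by (simp add: power2_eq_square)
      also have "\<dots> \<le> B / (real n)\<^sup>2"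
        using B[of n] by (intro divide_right_mono) auto
      finally show ?case
        using assms quarter_coeff_pos[of n] by (simp add: inverse_eq_divide)
    qed
  qed
qed

text \<open>
  Dividing \<open>n\<^sup>2\<close> by \<open>n + s\<close>, and \<open>(n + 1/4) (n + 3/4)\<close> by \<open>n + 1 + s\<close>, leaves the same quotient
  \<open>n - s\<close>, with remainders \<open>s\<^sup>2\<close> and \<open>(s + 1/4) (s + 3/4)\<close>. So in the differences of
  \<open>U n = n\<^sup>2 a n / (n + s)\<close> the divergent parts cancel and a combination of the terms of two
  neighbouring moments remains.
\<close>

lemma quarter_coeff_moment_Suc:
  assumes s: "s > 0"
  shows "(s + 1/4) * (s + 3/4) * (\<Sum>n. quarter_coeff n / (real n + (s + 1)))
       = s\<^sup>2 * (\<Sum>n. quarter_coeff n / (real n + s)) + 1 / (sqrt 2 * pi)"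
proof -
  let ?M = "\<lambda>s. \<Sum>n. quarter_coeff n / (real n + s)"
  define U where "U n = (real n)\<^sup>2 * quarter_coeff n / (real n + s)" for n
  have "(\<lambda>n. real n / (real n + s)) \<longlonglongrightarrow> 1"
    by real_asymp
  from tendsto_mult[OF quarter_coeff_asymptotic this]
  have "U \<longlonglongrightarrow> 1 / (sqrt 2 * pi)"
    by (simp add: U_def[abs_def] power2_eq_square mult_ac)
  from telescope_sums'[OF this]
  have "(\<lambda>n. U n - U (Suc n)) sums (- (1 / (sqrt 2 * pi)))"
    by (simp add: U_def)
  also have "(\<lambda>n. U n - U (Suc n)) = (\<lambda>n. s\<^sup>2 * (quarter_coeff n / (real n + s))
      - (s + 1/4) * (s + 3/4) * (quarter_coeff n / (real n + (s + 1))))"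
  proof
    fix n
    have U: "U (Suc n) = (real n + 1/4) * (real n + 3/4) * quarter_coeff n / (real n + (s + 1))"
      unfolding U_def quarter_coeff_Suc[symmetric] by (simp add: algebra_simps)
    have "real n + s > 0" "real n + (s + 1) > 0" using s by auto
    then show "U n - U (Suc n) = s\<^sup>2 * (quarter_coeff n / (real n + s))
      - (s + 1/4) * (s + 3/4) * (quarter_coeff n / (real n + (s + 1)))"
      unfolding U unfolding U_def
      by (simp add: divide_simps) (simp add: power2_eq_square algebra_simps)
  qed
  finally have shifted: "(\<lambda>n. s\<^sup>2 * (quarter_coeff n / (real n + s))
      - (s + 1/4) * (s + 3/4) * (quarter_coeff n / (real n + (s + 1)))) sums (- (1 / (sqrt 2 * pi)))" .
  have direct: "(\<lambda>n. s\<^sup>2 * (quarter_coeff n / (real n + s))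
      - (s + 1/4) * (s + 3/4) * (quarter_coeff n / (real n + (s + 1)))) sums
      (s\<^sup>2 * ?M s - (s + 1/4) * (s + 3/4) * ?M (s + 1))"
    by (intro sums_diff sums_mult summable_sums summable_quarter_coeff_div) (use s in auto)
  have "b = a + c" if "a - b = - c" for a b c :: real
    using that by simp
  from this[OF sums_unique2[OF direct shifted]] show ?thesis .
qed

lemma quarter_coeff_div_two:
  "quarter_coeff n * (1 / real (2*n + m + 1)) = quarter_coeff n / (real n + (real m + 1) / 2) / 2"
proof -
  have "real (2*n + m + 1) = (real n + (real m + 1) / 2) * 2"
    by simp
  then show ?thesis by (simp only: divide_divide_eq_left) simp
qed

lemma summable_quarter_coeff:
  "summable (\<lambda>n. quarter_coeff n * (1 / real (2*n + m + 1)))"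
  unfolding quarter_coeff_div_two by (intro summable_divide summable_quarter_coeff_div) simp

section \<open>The initial value of the recurrence\<close>

text \<open>
  The integrand is \<open>sec (t - \<pi>/4)\<close>; the primitive below is its classical one
  \<open>ln (sec + tan)\<close> at \<open>t - \<pi>/4\<close>.
\<close>

lemma has_integral_cos_plus_sin:
  "((\<lambda>t. sqrt 2 / (cos t + sin t)) has_integral ln (1 + sqrt 2)) {0..pi/4}"
proof -
  let ?G = "\<lambda>t. ln (sqrt 2 + sin t - cos t) - ln (cos t + sin t)"
  have "((\<lambda>t. sqrt 2 / (cos t + sin t)) has_integral (?G (pi/4) - ?G 0)) {0..pi/4}"
  proof (rule fundamental_theorem_of_calculus)
    fix t :: real assume t: "t \<in> {0..pi/4}"
    have "0 \<le> t" "t \<le> pi/4" using t by auto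
    then have "- (pi/2) < t" "t < pi/2" "t \<le> pi" using pi_gt_zero by linarith+
    with \<open>0 \<le> t\<close> have c: "cos t > 0" and s: "sin t \<ge> 0"
      by (simp_all add: cos_gt_zero_pi sin_ge_zero)
    have "sqrt 2 > 1" by simp
    moreover have "cos t \<le> 1" by simp
    ultimately have p: "sqrt 2 + sin t - cos t > 0" using s by linarith
    have q: "cos t + sin t > 0" using c s by linarith
    have "(?G has_real_derivative
        (cos t + sin t) / (sqrt 2 + sin t - cos t) - (cos t - sin t) / (cos t + sin t))
        (at t within {0..pi/4})"
      using p q by (auto intro!: derivative_eq_intros simp: add.commute)
    also have "(cos t + sin t) / (sqrt 2 + sin t - cos t) - (cos t - sin t) / (cos t + sin t)
        = ((cos t + sin t) * (cos t + sin t) - (sqrt 2 + sin t - cos t) * (cos t - sin t))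
          / ((sqrt 2 + sin t - cos t) * (cos t + sin t))"
      using p q by (subst diff_frac_eq) (auto simp: mult.commute)
    also have "(cos t + sin t) * (cos t + sin t) - (sqrt 2 + sin t - cos t) * (cos t - sin t)
        = sqrt 2 * (sqrt 2 + sin t - cos t)"
    proof -
      have "(cos t + sin t) * (cos t + sin t) - (sqrt 2 + sin t - cos t) * (cos t - sin t)
          = 2 * (cos t * cos t + sin t * sin t) + sqrt 2 * (sin t - cos t)"
        by algebra
      also have "\<dots> = sqrt 2 * sqrt 2 + sqrt 2 * (sin t - cos t)"
        by (simp only: sin_cos_squared_add3) simp
      finally show ?thesis by (simp only: algebra_simps)
    qed
    also have "sqrt 2 * (sqrt 2 + sin t - cos t) / ((sqrt 2 + sin t - cos t) * (cos t + sin t))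
        = sqrt 2 / (cos t + sin t)"
      using p q by simp
    finally show "(?G has_vector_derivative sqrt 2 / (cos t + sin t)) (at t within {0..pi/4})"
      by (simp add: has_real_derivative_iff_has_vector_derivative)
  qed simp
  moreover have "?G (pi/4) = 0"
    by (simp add: sin_45 cos_45)
  moreover have "?G 0 = - ln (1 + sqrt 2)"
  proof -
    have "sqrt 2 - 1 = inverse (1 + sqrt 2)"
      by (rule inverse_unique[symmetric]) (simp add: algebra_simps)
    then show ?thesis by (simp add: ln_inverse add_pos_pos)
  qed
  ultimately show ?thesis by simp
qed

text \<open>
  Replace the factor \<open>w n\<close> of \<open>a n\<close> by the mean of \<open>cos (2t)^(2n)\<close> and sum under the integral.
  By \<open>1 + cos 2t = 2 cos\<^sup>2 t\<close> and \<open>1 - cos 2t = 2 sin\<^sup>2 t\<close> the square roots disappear.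
\<close>

lemma suminf_quarter_coeff_0:
  "(\<Sum>n. quarter_coeff n * (1 / real (2*n + 1))) = 4 / pi * ln (1 + sqrt 2)"
proof -
  let ?f = "\<lambda>n t. wallis_ratio (2*n) / (2*real n + 1) * cos (2*t) ^ (2*n)"
  have summ: "summable (\<lambda>n. quarter_coeff n * (1 / real (2*n + 1)))"
    using summable_quarter_coeff[of 0] by simp
  let ?I = "\<lambda>n. pi / 4 * (quarter_coeff n * (1 / real (2*n + 1)))"
  have "((\<lambda>t. sqrt 2 / (cos t + sin t)) has_integral suminf ?I) {0..pi/4}"
  proof (rule has_integral_suminf_nonneg)
    show "(?f n has_integral ?I n) {0..pi/4}" for n
      using has_integral_mult_right[OF has_integral_cos_double_even_power,
          of "wallis_ratio (2*n) / (2*real n + 1)" n]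
      by (simp add: quarter_coeff_def mult_ac add_ac)
    show "summable ?I"
      by (intro summable_mult summ)
    show "0 \<le> ?f n t" for n t
      using wallis_ratio_pos[of "2*n"] by simp
  next
    fix t :: real assume t: "t \<in> {0<..<pi/4}"
    have c2: "0 < cos (2*t)" using t by (intro cos_gt_zero_pi) auto
    have "cos (2*t) < cos 0" using t by (intro cos_monotone_0_pi) auto
    then have c1: "cos (2*t) < 1" by simp
    have c: "cos t > 0" using t by (intro cos_gt_zero_pi) auto
    have s: "sin t > 0" using t by (intro sin_gt_zero) auto
    have A: "1 + cos (2*t) = 2 * (cos t)\<^sup>2" by (simp add: cos_double_cos)
    have B: "1 - cos (2*t) = 2 * (sin t)\<^sup>2" by (simp add: cos_double_sin)
    have D: "cos (2*t) = (cos t - sin t) * (cos t + sin t)"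
      unfolding cos_double by (simp add: power2_eq_square algebra_simps)
    have "(sqrt (1 + cos (2*t)) - sqrt (1 - cos (2*t))) / cos (2*t)
        = sqrt 2 * (cos t - sin t) / cos (2*t)"
      unfolding A B using c s by (simp add: real_sqrt_mult algebra_simps)
    also have "\<dots> = sqrt 2 / (cos t + sin t)"
      using c2 unfolding D by auto
    finally show "(\<lambda>n. ?f n t) sums (sqrt 2 / (cos t + sin t))"
      using wallis_ratio_even_integrated_sums[OF c2 c1] by simp
  qed
  then have "suminf ?I = ln (1 + sqrt 2)"
    using has_integral_cos_plus_sin has_integral_unique by blast
  then have "pi / 4 * (\<Sum>n. quarter_coeff n * (1 / real (2*n + 1))) = ln (1 + sqrt 2)"
    by (simp only: suminf_mult[OF summ])
  then show ?thesis by (simp add: field_simps)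
qed

section \<open>The generating function as an elliptic integral\<close>

lemma ellK_sqrt_eq_integral:
  assumes x: "0 < x" "x < 1"
  shows "1 / sqrt (1 + x) * ellK (sqrt (2*x / (1 + x)))
       = integral {0..pi/2} (\<lambda>\<theta>. 1 / sqrt (1 + x * cos (2*\<theta>)))"
proof -
  have "1 / sqrt (1 - (sqrt (2*x / (1 + x)))\<^sup>2 * (sin \<theta>)\<^sup>2)
      = sqrt (1 + x) * (1 / sqrt (1 + x * cos (2*\<theta>)))" for \<theta>
  proof -
    have "1 - (sqrt (2*x / (1 + x)))\<^sup>2 * (sin \<theta>)\<^sup>2 = (1 + x * cos (2*\<theta>)) / (1 + x)"
      unfolding cos_double_sin using x by (simp add: field_simps)
    then show ?thesis by (simp add: real_sqrt_divide)
  qed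
  then have "ellK (sqrt (2*x / (1 + x)))
      = integral {0..pi/2} (\<lambda>\<theta>. sqrt (1 + x) * (1 / sqrt (1 + x * cos (2*\<theta>))))"
    by (simp only: ellK_def)
  then show ?thesis
    using x by (simp only: integral_mult_right) simp
qed

text \<open>
  The Wallis ratios only integrate the even part in \<open>cos (2\<theta>)\<close>, whose series has
  nonnegative terms. It is the average of the integrand at \<open>\<theta>\<close> and at \<open>\<pi>/2 - \<theta>\<close>, so
  its integral over \<open>[0, \<pi>/4]\<close> is half the integral of \<open>1 / sqrt (1 + x cos 2\<theta>)\<close> over
  \<open>[0, \<pi>/2]\<close>.
\<close>

lemma quarter_coeff_sums:
  assumes x: "0 < x" "x < 1"
  shows "(\<lambda>n. quarter_coeff n * x ^ (2*n)) sums
           (2 / pi * (1 / sqrt (1 + x) * ellK (sqrt (2*x / (1 + x)))))"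
proof -
  define h where "h c = 1 / sqrt (1 + x * c)" for c
  let ?f = "\<lambda>n \<theta>. wallis_ratio (2*n) * (x * cos (2*\<theta>)) ^ (2*n)"
  let ?I = "\<lambda>n. pi / 4 * (quarter_coeff n * x ^ (2*n))"
  have summ: "summable (\<lambda>n. quarter_coeff n * x ^ (2*n))"
  proof (rule summable_comparison_test')
    show "summable (\<lambda>n. wallis_ratio (2*n) * x ^ (2*n))"
      using wallis_ratio_even_sums[of x] x by (auto intro: sums_summable)
    show "norm (quarter_coeff n * x ^ (2*n)) \<le> wallis_ratio (2*n) * x ^ (2*n)" for n
      using wallis_ratio_pos[of "2*n"] wallis_ratio_pos[of n] wallis_ratio_le_1[of n] x
      by (simp add: quarter_coeff_def abs_mult mult_left_le_one_le mult_right_mono)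
  qed
  \<comment> \<open>Strictness keeps the integrand continuous and the binomial series convergent, even where the cosine is \<open>1\<close> or \<open>-1\<close>.\<close>
  have xc: "\<bar>x * cos u\<bar> < 1" for u
  proof -
    have "\<bar>x * cos u\<bar> \<le> x * 1"
      using x unfolding abs_mult by (intro mult_mono) auto
    then show ?thesis using x by simp
  qed
  have "((\<lambda>\<theta>. (h (- cos (2*\<theta>)) + h (cos (2*\<theta>))) / 2) has_integral suminf ?I) {0..pi/4}"
  proof (rule has_integral_suminf_nonneg)
    show "(?f n has_integral ?I n) {0..pi/4}" for n
      using has_integral_mult_right[OF has_integral_cos_double_even_power,
          of "wallis_ratio (2*n) * x ^ (2*n)" n]
      by (simp add: quarter_coeff_def mult_ac power_mult_distrib)
    show "summable ?I"
      by (intro summable_mult summ)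
    show "0 \<le> ?f n \<theta>" for n \<theta>
      using wallis_ratio_pos[of "2*n"] by simp
    show "(\<lambda>n. ?f n \<theta>) sums ((h (- cos (2*\<theta>)) + h (cos (2*\<theta>))) / 2)" for \<theta>
      using wallis_ratio_even_sums[OF xc[of "2*\<theta>"]] by (simp add: h_def)
  qed
  from has_integral_mult_right[OF this, of 2]
  have even: "((\<lambda>\<theta>. h (- cos (2*\<theta>)) + h (cos (2*\<theta>))) has_integral 2 * suminf ?I) {0..pi/4}"
    by (simp add: add_divide_distrib)
  have pos: "1 + x * cos u > 0" for u
    using xc[of u] by linarith
  have cont: "continuous_on A (\<lambda>\<theta>. h (cos (2*\<theta>)))" for A
    unfolding h_def using pos by (intro continuous_intros ballI) (simp add: less_imp_neq[symmetric])
  let ?J = "\<lambda>a b. integral {a..b} (\<lambda>\<theta>. h (cos (2*\<theta>)))"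
  have "((\<lambda>\<theta>. h (cos (2*\<theta>))) has_integral ?J (pi/4) (pi/2)) {pi/4..pi/2}"
    by (intro integrable_integral integrable_continuous_interval cont)
  then have "((\<lambda>\<theta>. h (cos (2*(-\<theta>)))) has_integral ?J (pi/4) (pi/2)) {-(pi/2)..-(pi/4)}"
    using has_integral_reflect_real[of "\<lambda>\<theta>. h (cos (2*\<theta>))" _ "pi/2" "pi/4"] by simp
  \<comment> \<open>Combined with the previous step, this is the reflection at \<open>\<pi>/4\<close>, which negates \<open>cos (2\<theta>)\<close>.\<close>
  from has_integral_shift_real_ivl[OF this, of "-(pi/2)"]
  have refl: "((\<lambda>\<theta>. h (- cos (2*\<theta>))) has_integral ?J (pi/4) (pi/2)) {0..pi/4}"
    by (simp add: algebra_simps)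
  have "((\<lambda>\<theta>. h (cos (2*\<theta>))) has_integral ?J 0 (pi/4)) {0..pi/4}"
    by (intro integrable_integral integrable_continuous_interval cont)
  from has_integral_unique[OF has_integral_add[OF refl this] even]
  have "?J (pi/4) (pi/2) + ?J 0 (pi/4) = 2 * suminf ?I" .
  moreover have "?J 0 (pi/4) + ?J (pi/4) (pi/2) = ?J 0 (pi/2)"
    by (intro Henstock_Kurzweil_Integration.integral_combine integrable_continuous_interval cont) auto
  ultimately have "?J 0 (pi/2) = pi / 2 * (\<Sum>n. quarter_coeff n * x ^ (2*n))"
    using suminf_mult[OF summ, of "pi/4"] by simp
  then have "(\<Sum>n. quarter_coeff n * x ^ (2*n)) = 2 / pi * ?J 0 (pi/2)"
    by (simp add: field_simps)
  then show ?thesis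
    unfolding ellK_sqrt_eq_integral[OF x] using summ by (simp add: sums_iff h_def)
qed

lemma has_integral_power_ellK:
  "((\<lambda>x. x ^ m / sqrt (1 + x) * ellK (sqrt (2*x / (1 + x)))) has_integral
     (pi / 2 * (\<Sum>n. quarter_coeff n * (1 / real (2*n + m + 1))))) {0..1}"
proof -
  have "((\<lambda>x. 2 / pi * (x ^ m / sqrt (1 + x) * ellK (sqrt (2*x / (1 + x))))) has_integral
     (\<Sum>n. quarter_coeff n * (1 / real (2*n + m + 1)))) {0..1}"
  proof (rule has_integral_suminf_nonneg)
    fix n
    have "((\<lambda>x::real. x ^ (2*n + m)) has_integral
        (1 ^ Suc (2*n + m) / real (Suc (2*n + m)) - 0 ^ Suc (2*n + m) / real (Suc (2*n + m)))) {0..1}"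
      by (rule fundamental_theorem_of_calculus)
        (auto intro!: derivative_eq_intros simp flip: has_real_derivative_iff_has_vector_derivative simp del: power_Suc)
    from has_integral_mult_right[OF this, of "quarter_coeff n"]
    show "((\<lambda>x. quarter_coeff n * x ^ (2*n + m)) has_integral
        (quarter_coeff n * (1 / real (2*n + m + 1)))) {0..1}"
      by simp
  next
    show "0 \<le> quarter_coeff n * x ^ (2*n + m)" if "x \<in> {0<..<1}" for n and x :: real
      using that quarter_coeff_pos[of n] by simp
  next
    fix x :: real assume "x \<in> {0<..<1}"
    then have "(\<lambda>n. quarter_coeff n * x ^ (2*n)) sums
           (2 / pi * (1 / sqrt (1 + x) * ellK (sqrt (2*x / (1 + x)))))"
      by (intro quarter_coeff_sums) auto
    from sums_mult[OF this, of "x ^ m"]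
    show "(\<lambda>n. quarter_coeff n * x ^ (2*n + m)) sums
           (2 / pi * (x ^ m / sqrt (1 + x) * ellK (sqrt (2*x / (1 + x)))))"
      by (simp add: power_add mult_ac)
  qed (rule summable_quarter_coeff)
  from has_integral_mult_right[OF this, of "pi / 2"] show ?thesis
    by simp
qed

section \<open>The closed form for even exponents\<close>

text \<open>
  This is the moment recurrence at \<open>s = l + 1/2\<close>, where \<open>M s = 2 S l\<close>, cleared of denominators.
\<close>

lemma suminf_quarter_coeff_even_Suc:
  fixes l :: nat
  defines "S \<equiv> \<lambda>l. \<Sum>n. quarter_coeff n * (1 / real (2*n + 2*l + 1))"
  shows "(4*real l + 3) * (4*real l + 5) * S (Suc l)
       = 4 * (2*real l + 1)\<^sup>2 * S l + 4 * sqrt 2 / pi"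
proof -
  have S: "S l = (\<Sum>n. quarter_coeff n / (real n + (real l + 1/2))) / 2" for l
  proof -
    have "quarter_coeff n * (1 / real (2*n + 2*l + 1))
        = quarter_coeff n / (real n + (real l + 1/2)) / 2" for n
      by (simp add: field_simps)
    then show ?thesis
      unfolding S_def by (simp only: suminf_divide[OF summable_quarter_coeff_div])
  qed
  have "(real l + 3/4) * (real l + 5/4) * (2 * S (Suc l))
      = (real l + 1/2)\<^sup>2 * (2 * S l) + 1 / (sqrt 2 * pi)"
    using quarter_coeff_moment_Suc[of "real l + 1/2"] unfolding S by (simp add: algebra_simps)
  moreover have "(4*real l + 3) * (4*real l + 5) * S (Suc l)
      = 8 * ((real l + 3/4) * (real l + 5/4) * (2 * S (Suc l)))"
    by (simp add: algebra_simps)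
  moreover have "8 * ((real l + 1/2)\<^sup>2 * (2 * S l)) = 4 * (2*real l + 1)\<^sup>2 * S l"
    by (simp add: power2_eq_square algebra_simps)
  moreover have "8 * (1 / (sqrt 2 * pi)) = 4 * sqrt 2 / pi"
    by (simp add: divide_simps)
  ultimately show ?thesis
    by (simp only: distrib_left)
qed

text \<open>
  The solution of the homogeneous recurrence with value \<open>1\<close> at \<open>l = 0\<close>.
\<close>

definition even_factor :: "nat \<Rightarrow> real" where
  "even_factor l = 4 ^ l * real ((2*l) choose l) / (real (4*l + 1) * real ((4*l) choose (2*l)))"

lemma even_factor_eq: "even_factor l = wallis_ratio l / ((4*real l + 1) * wallis_ratio (2*l))"
proof -
  have "(4::real) ^ (2*l) = 4 ^ l * 4 ^ l"
    by (simp add: mult_2 power_add)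
  then show ?thesis
    by (simp add: even_factor_def wallis_ratio_def mult_ac add_ac)
qed

lemma even_factor_pos: "0 < even_factor l"
  unfolding even_factor_eq using wallis_ratio_pos by simp

lemma even_factor_Suc:
  "(4*real l + 3) * (4*real l + 5) * even_factor (Suc l) = 4 * (2*real l + 1)\<^sup>2 * even_factor l"
proof -
  have "wallis_ratio l > 0" "wallis_ratio (2*l) > 0" by (rule wallis_ratio_pos)+
  then show ?thesis
    by (simp add: even_factor_eq wallis_ratio_Suc divide_simps)
      (simp add: power2_eq_square algebra_simps)
qed

text \<open>
  Variation of constants: dividing the recurrence by \<open>even_factor\<close> turns it into a summation. In
  this form the summands are the reciprocals of \<open>even_factor\<close> up to the factor
  \<open>(2k + 1)\<^sup>2\<close>; spelling them out with binomial coefficients gives the sum over \<open>j = k + 1\<close> in the theorem.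
\<close>

lemma suminf_quarter_coeff_even:
  "(\<Sum>n. quarter_coeff n * (1 / real (2*n + 2*l + 1)))
   = 1 / pi * even_factor l
     * (4 * ln (1 + sqrt 2) + sqrt 2 * (\<Sum>k<l. 1 / ((2*real k + 1)\<^sup>2 * even_factor k)))"
proof (induction l)
  case 0
  show ?case using suminf_quarter_coeff_0 by (simp add: even_factor_def)
next
  case (Suc l)
  let ?T = "4 * ln (1 + sqrt 2) + sqrt 2 * (\<Sum>k<l. 1 / ((2*real k + 1)\<^sup>2 * even_factor k))"
  let ?d = "(4*real l + 3) * (4*real l + 5)"
  have e: "even_factor l \<noteq> 0" using even_factor_pos[of l] by simp
  have "?d * (1 / pi * even_factor (Suc l)
         * (?T + sqrt 2 * (1 / ((2*real l + 1)\<^sup>2 * even_factor l))))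
      = 1 / pi * (?d * even_factor (Suc l)) * (?T + sqrt 2 * (1 / ((2*real l + 1)\<^sup>2 * even_factor l)))"
    by (simp only: mult_ac)
  also have "\<dots> = 4 * (2*real l + 1)\<^sup>2 * (1 / pi * even_factor l * ?T) + 4 * sqrt 2 / pi"
    unfolding even_factor_Suc using e by (simp add: field_simps)
  also have "\<dots> = ?d * (\<Sum>n. quarter_coeff n * (1 / real (2*n + 2 * Suc l + 1)))"
    unfolding suminf_quarter_coeff_even_Suc Suc.IH ..
  finally have "(\<Sum>n. quarter_coeff n * (1 / real (2*n + 2 * Suc l + 1)))
      = 1 / pi * even_factor (Suc l) * (?T + sqrt 2 * (1 / ((2*real l + 1)\<^sup>2 * even_factor l)))"
    by (simp only: mult_cancel_left) simp
  then show ?case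
    by (simp only: sum.lessThan_Suc distrib_left add.assoc)
qed

section \<open>The three evaluations\<close>

theorem theorem3p2:
  fixes m :: nat
  shows
    "(summable (\<lambda>n. 1 / 64 ^ n * real ((2*n) choose n) * real ((4*n) choose (2*n))
                     * (1 / real (2*n + m + 1)))
      \<and> (\<lambda>x. x ^ m / sqrt (1 + x) * ellK (sqrt (2*x / (1 + x)))) integrable_on {0..1}
      \<and> (\<Sum>n. 1 / 64 ^ n * real ((2*n) choose n) * real ((4*n) choose (2*n))
               * (1 / real (2*n + m + 1)))
        = 2 / pi * integral {0..1} (\<lambda>x. x ^ m / sqrt (1 + x) * ellK (sqrt (2*x / (1 + x)))))
   \<and> (\<forall>l::nat. m = 2*l + 1 \<longrightarrow>
        summable (\<lambda>n. 1 / 64 ^ n * real ((2*n) choose n) * real ((4*n) choose (2*n))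
                       * (1 / real (n + l + 1)))
        \<and> (\<Sum>n. 1 / 64 ^ n * real ((2*n) choose n) * real ((4*n) choose (2*n))
                 * (1 / real (2*n + m + 1)))
          = 1 / 2 * (\<Sum>n. 1 / 64 ^ n * real ((2*n) choose n) * real ((4*n) choose (2*n))
                           * (1 / real (n + l + 1))))
   \<and> (\<forall>l::nat. m = 2*l \<longrightarrow>
        (\<Sum>n. 1 / 64 ^ n * real ((2*n) choose n) * real ((4*n) choose (2*n))
               * (1 / real (2*n + 2*l + 1)))
        = 1 / pi
          * (4 ^ l * real ((2*l) choose l) / (real (4*l + 1) * real ((4*l) choose (2*l))))
          * (4 * ln (1 + sqrt 2)
             + sqrt 2 * (\<Sum>j = 1..l.
                 real ((4*j - 3) * ((4*j - 4) choose (2*j - 2)))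
                 / (real ((2*j - 1)\<^sup>2) * 4 ^ (j - 1) * real ((2*j - 2) choose (j - 1))))))"
  unfolding quarter_coeff_eq[symmetric] even_factor_def[symmetric]
proof (intro conjI allI impI)
  show "summable (\<lambda>n. quarter_coeff n * (1 / real (2*n + m + 1)))"
    by (rule summable_quarter_coeff)
  show "(\<lambda>x. x ^ m / sqrt (1 + x) * ellK (sqrt (2*x / (1 + x)))) integrable_on {0..1}"
    using has_integral_power_ellK by blast
  show "(\<Sum>n. quarter_coeff n * (1 / real (2*n + m + 1)))
      = 2 / pi * integral {0..1} (\<lambda>x. x ^ m / sqrt (1 + x) * ellK (sqrt (2*x / (1 + x))))"
    unfolding integral_unique[OF has_integral_power_ellK] by simp
next
  fix l assume m: "m = 2*l + 1"
  show summ: "summable (\<lambda>n. quarter_coeff n * (1 / real (n + l + 1)))"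
    using summable_quarter_coeff_div[of "real l + 1"] by (simp add: add_ac)
  have "quarter_coeff n * (1 / real (2*n + m + 1)) = 1 / 2 * (quarter_coeff n * (1 / real (n + l + 1)))" for n
    unfolding m by (simp add: field_simps)
  then show "(\<Sum>n. quarter_coeff n * (1 / real (2*n + m + 1)))
      = 1 / 2 * (\<Sum>n. quarter_coeff n * (1 / real (n + l + 1)))"
    by (simp only: suminf_mult[OF summ])
next
  fix l assume "m = 2*l"
  have "(\<Sum>j = 1..l. real ((4*j - 3) * ((4*j - 4) choose (2*j - 2)))
          / (real ((2*j - 1)\<^sup>2) * 4 ^ (j - 1) * real ((2*j - 2) choose (j - 1))))
      = (\<Sum>k<l. 1 / ((2*real k + 1)\<^sup>2 * even_factor k))"
    unfolding sum.atLeast1_atMost_eq[folded One_nat_def]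
  proof (intro sum.cong refl)
    fix k
    have "4 * Suc k - 3 = 4*k + 1" "4 * Suc k - 4 = 4*k" "2 * Suc k - 2 = 2*k"
      "2 * Suc k - 1 = 2*k + 1" "Suc k - 1 = k" "real ((2*k + 1)\<^sup>2) = (2*real k + 1)\<^sup>2"
      by auto
    then show "real ((4 * Suc k - 3) * ((4 * Suc k - 4) choose (2 * Suc k - 2)))
          / (real ((2 * Suc k - 1)\<^sup>2) * 4 ^ (Suc k - 1) * real ((2 * Suc k - 2) choose (Suc k - 1)))
        = 1 / ((2*real k + 1)\<^sup>2 * even_factor k)"
      by (simp only: even_factor_def of_nat_mult) simp
  qed
  then show "(\<Sum>n. quarter_coeff n * (1 / real (2*n + 2*l + 1)))
      = 1 / pi * even_factor l * (4 * ln (1 + sqrt 2)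
         + sqrt 2 * (\<Sum>j = 1..l. real ((4*j - 3) * ((4*j - 4) choose (2*j - 2)))
          / (real ((2*j - 1)\<^sup>2) * 4 ^ (j - 1) * real ((2*j - 2) choose (j - 1)))))"
    using suminf_quarter_coeff_even[of l] by simp
qed

end
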